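(* Let $\mathcal V=\{1,\dots,n\}$, let $\mathcal E\subset\{\{i,j\}:i,j\in\mathcal V,\ i\ne j\}$, let $K$ be an integer with $0\le K\le|\mathcal E|$, and let $f_i:\mathbb R^p\to\mathbb R$ for $i\in\mathcal V$. For $\gamma>0$ consider the problem $$(\mathrm{P}_\gamma)\qquad\underset{x_1,\dots,x_n\in\mathbb R^p}{\text{minimize}}\quad\sum_{i\in\mathcal V}f_i(x_i)+\gamma\,\tau_K(x_1,\dots,x_n),$$ and the constrained problem $$(\mathrm{Q})\qquad\underset{x_1,\dots,x_n\in\mathbb R^p}{\text{minimize}}\quad\sum_{i\in\mathcal V}f_i(x_i)\quad\text{subject to}\quad\tau_K(x_1,\dots,x_n)=0.$$ 1. Suppose that $f_i$ is $L_i$-smooth for each $i\in\mathcal V$. For each $\gamma>0$ let $\boldsymbol x^\gamma=(x_1^\gamma,\dots,x_n^\gamma)$ be an optimal solution of $(\mathrm{P}_\gamma)$, and suppose there exists $C>0$ such that $\|x_i^\gamma\|_2\le C$ for all $i\in\mathcal V$ and any $\gamma>0$. Then $\boldsymbol x^\gamma$ is optimal to $(\mathrm{Q})$ if $$\gamma>\sum_{i\in\mathcal V}\big(\|\nabla f_i(0)\|_2+2L_iC\big).\qquad( * )$$ 2. Suppose that $f_i$ is $L_i$-smooth and convex for each $i\in\mathcal V$. For each $\gamma>0$ let $\boldsymbol x^\gamma=(x_1^\gamma,\dots,x_n^\gamma)$ be a locally optimal solution of $(\mathrm{P}_\gamma)$, and suppose there exists $C>0$ such that $\|x_i^\gamma\|_2\le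 C$ for all $i\in\mathcal V$ and any $\gamma>0$. Then $\boldsymbol x^\gamma$ is locally optimal to $(\mathrm{Q})$ if the inequality $( * )$ holds.
   Context: A differentiable function $f:\mathbb R^p\to\mathbb R$ is $L$-smooth ($L>0$) if $\|\nabla f(x)-\nabla f(y)\|_2\le L\|x-y\|_2$ for all $x,y\in\mathbb R^p$. For $(x_1,\dots,x_n)\in(\mathbb R^p)^n$ let $\xi=(\|x_i-x_j\|_2)_{\{i,j\}\in\mathcal E}\in\mathbb R^{|\mathcal E|}$ and let $\xi_{(i)}$ be the $i$-th largest component of $\xi$. Then $\tau_K(x_1,\dots,x_n):=\xi_{(K+1)}+\cdots+\xi_{(|\mathcal E|)}$ is the sum of the $|\mathcal E|-K$ smallest components of $\xi$. The constraint $\tau_K(x_1,\dots,x_n)=0$ is equivalent to the cardinality constraint $|\{\{i,j\}\in\mathcal E:\|x_i-x_j\|_2>0\}|\le K$. *)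

theory Defs
  imports "HOL-Analysis.Analysis" "HOL-Library.Multiset"
begin

(* The library only has the relational form GDERIV of the gradient. *)
definition grad :: "('a::real_inner \<Rightarrow> real) \<Rightarrow> 'a \<Rightarrow> 'a" where
  "grad f x = (THE D. GDERIV f x :> D)"

lemma grad_eqI: "grad f x = D" if "GDERIV f x :> D"
proof -
  have "D' = D" if "GDERIV f x :> D'" for D'
  proof -
    have "(\<lambda>h. h \<bullet> D') = (\<lambda>h. h \<bullet> D)"
      using has_derivative_unique that \<open>GDERIV f x :> D\<close> unfolding gderiv_def by blast
    then show ?thesis
      by (metis vector_eq_ldot)
  qed
  with that show ?thesis
    unfolding grad_def by blast
qed

lemma gderiv_grad:
  fixes f :: "'a::euclidean_space \<Rightarrow> real"
  assumes "f differentiable at x"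
  shows "GDERIV f x :> grad f x"
proof -
  obtain f' where f': "(f has_derivative f') (at x)"
    using assms unfolding differentiable_def by blast
  then interpret linear f'
    by (rule has_derivative_linear)
  have "f' = (\<lambda>h. h \<bullet> adjoint f' 1)"
    using adjoint_works[OF linear_axioms, of _ 1] by (auto simp: fun_eq_iff)
  with f' have "GDERIV f x :> adjoint f' 1"
    unfolding gderiv_def by simp
  with grad_eqI show ?thesis by metis
qed

definition L_smooth :: "real \<Rightarrow> ('a::real_inner \<Rightarrow> real) \<Rightarrow> bool" where
  "L_smooth L f \<longleftrightarrow> L > 0 \<and> (\<forall>x. f differentiable at x) \<and>
     (\<forall>x y. norm (grad f x - grad f y) \<le> L * norm (x - y))"

(* An edge is an unordered pair {i, j}; by symmetry of the norm the value below does not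
   depend on the order of i and j, see edge_length_pair. *)
definition edge_length :: "real ^ 'p ^ 'n \<Rightarrow> 'n set \<Rightarrow> real" where
  "edge_length x e = (THE d. \<exists>i j. e = {i, j} \<and> d = norm (x $ i - x $ j))"

lemma edge_length_pair: "edge_length x {i, j} = norm (x $ i - x $ j)"
  unfolding edge_length_def
  by (rule the_equality) (auto simp: doubleton_eq_iff norm_minus_commute)

(* The i-th largest component (1 \<le> i \<le> card E, counted with multiplicity) of the
   vector of edge lengths. *)
definition ith_largest_edge_length :: "'n set set \<Rightarrow> real ^ 'p ^ 'n \<Rightarrow> nat \<Rightarrow> real" where
  "ith_largest_edge_length E x i =
     rev (sorted_list_of_multiset (image_mset (edge_length x) (mset_set E))) ! (i - 1)"

definition tau :: "'n set set \<Rightarrow> nat \<Rightarrow> real ^ 'p ^ 'n \<Rightarrow> real" where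
  "tau E K x = (\<Sum>i = K + 1..card E. ith_largest_edge_length E x i)"

definition total_cost :: "('n::finite \<Rightarrow> real ^ 'p \<Rightarrow> real) \<Rightarrow> real ^ 'p ^ 'n \<Rightarrow> real" where
  "total_cost f x = (\<Sum>i\<in>UNIV. f i (x $ i))"

definition penalized_cost ::
    "('n::finite \<Rightarrow> real ^ 'p \<Rightarrow> real) \<Rightarrow> 'n set set \<Rightarrow> nat \<Rightarrow> real \<Rightarrow> real ^ 'p ^ 'n \<Rightarrow> real" where
  "penalized_cost f E K \<gamma> x = total_cost f x + \<gamma> * tau E K x"

definition optimal :: "('a \<Rightarrow> real) \<Rightarrow> 'a set \<Rightarrow> 'a \<Rightarrow> bool" where
  "optimal F S x \<longleftrightarrow> is_arg_min F (\<lambda>y. y \<in> S) x"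

definition locally_optimal :: "('a::metric_space \<Rightarrow> real) \<Rightarrow> 'a set \<Rightarrow> 'a \<Rightarrow> bool" where
  "locally_optimal F S x \<longleftrightarrow> (\<exists>\<epsilon>>0. optimal F (S \<inter> ball x \<epsilon>) x)"

end

theory Submission imports Defs begin

text \<open>
  Why the penalty is exact. The function \<open>tau E K\<close> is the minimum, over all sets \<open>S\<close> of
  \<open>card E - K\<close> edges, of the total length of the edges in \<open>S\<close>
  (\<open>tau_attained\<close>, \<open>tau_le_sum\<close>). Let \<open>S\<close> attain this minimum at \<open>x\<close>. Moving every vertex of a
  connected component of the graph with edge set \<open>S\<close> to one chosen vertex of that component collapses
  all edges of \<open>S\<close>, and no vertex moves further than the total length of \<open>S\<close>, that is, further than
  \<open>tau E K x\<close> (\<open>contract_edges\<close>).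

  Going only a fraction \<open>t\<close> of the way scales all edges of \<open>S\<close> by \<open>1 - t\<close>, hence
  lowers \<open>tau\<close> by at least \<open>t * tau E K x\<close>. The points stay in the ball of radius \<open>C\<close>, where
  \<open>f i\<close> is Lipschitz with constant \<open>norm (grad (f i) 0) + L i * C\<close> (\<open>L_smooth_lipschitz_on_cball\<close>), so
  the cost rises by at most \<open>t * tau E K x\<close> times the sum of these constants.
  If \<open>\<gamma>\<close> exceeds that sum and \<open>tau E K x > 0\<close>, the penalized cost drops for arbitrarily small \<open>t\<close>,
  and \<open>x\<close> is not even locally optimal (\<open>locally_optimal_imp_tau_zero\<close>). So local and global
  minimizers alike satisfy \<open>tau E K x = 0\<close>; on that constraint set the penalized cost is the cost
  itself, and optimality carries over.
\<close>

section \<open>The sum of the smallest edge lengths as a minimum\<close>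

text \<open>The exchange argument: a bijection from \<open>T - S\<close> to \<open>S - T\<close> never decreases \<open>g\<close>.\<close>

lemma sum_smallest_le:
  fixes g :: "'a \<Rightarrow> 'b::ordered_comm_monoid_add"
  assumes "finite S" "finite T" "card S = card T"
    and le: "\<And>a b. a \<in> T \<Longrightarrow> b \<in> S - T \<Longrightarrow> g a \<le> g b"
  shows "sum g T \<le> sum g S"
proof -
  have "card (T - S) = card (S - T)"
    using assms(1-3) by (simp add: card_Diff_subset_Int Int_commute)
  then obtain h where h: "bij_betw h (T - S) (S - T)"
    using assms(1,2) by (meson finite_Diff finite_same_card_bij)
  have "sum g (T - S) \<le> (\<Sum>a\<in>T - S. g (h a))"
    using h by (intro sum_mono le) (auto dest: bij_betwE)
  also have "\<dots> = sum g (S - T)"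
    using h by (rule sum.reindex_bij_betw)
  finally have "sum g (T - S) + sum g (T \<inter> S) \<le> sum g (S - T) + sum g (S \<inter> T)"
    by (simp add: Int_commute add_right_mono)
  then show ?thesis
    using assms(1,2) by (metis sum.Int_Diff add.commute)
qed

text \<open>Indices run from \<open>K + 1\<close> to \<open>card E\<close> in the descending list, hence from \<open>card E - K - 1\<close> down to
  \<open>0\<close> in the ascending one.\<close>

lemma tau_eq_sum_list_take:
  assumes "K \<le> card E"
  shows "tau E K x =
    sum_list (take (card E - K)
      (sorted_list_of_multiset (image_mset (edge_length x) (mset_set E))))"
proof -
  let ?xs = "sorted_list_of_multiset (image_mset (edge_length x) (mset_set E))"
  have len: "length ?xs = card E"
    by (metis mset_sorted_list_of_multiset size_image_mset size_mset size_mset_set)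
  have "tau E K x = (\<Sum>i = K + 1..card E. ?xs ! (card E - i))"
    unfolding tau_def ith_largest_edge_length_def
    by (intro sum.cong) (auto simp: rev_nth len)
  also have "\<dots> = (\<Sum>j<card E - K. ?xs ! j)"
    by (rule sum.reindex_bij_witness[of _ "\<lambda>j. card E - j" "\<lambda>i. card E - i"])
      (use assms in auto)
  also have "\<dots> = sum_list (take (card E - K) ?xs)"
    by (simp add: sum_list_sum_nth len atLeast0LessThan min.absorb1 min.absorb2)
  finally show ?thesis .
qed

text \<open>Sorting the edges by length, rather than their lengths, turns the initial segment of the list into
  a set of edges, even if several edges have the same length.\<close>

lemma tau_eq_sum_smallest:
  assumes "K \<le> card E" "finite E"
  obtains T where "T \<subseteq> E" "card T = card E - K" "tau E K x = sum (edge_length x) T"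
    "\<And>a b. a \<in> T \<Longrightarrow> b \<in> E - T \<Longrightarrow> edge_length x a \<le> edge_length x b"
proof -
  let ?g = "edge_length x"
  let ?m = "card E - K"
  obtain es0 where es0: "set es0 = E" "distinct es0"
    using finite_distinct_list[OF \<open>finite E\<close>] by blast
  define es where "es = sort_key ?g es0"
  have es: "set es = E" "distinct es" "sorted (map ?g es)"
    using es0 by (auto simp: es_def)
  have "length es = card E"
    using es distinct_card by metis
  have "mset (map ?g es) = image_mset ?g (mset_set E)"
    using es by (simp flip: mset_set_set)
  with es(3) have sorted_lengths: "sorted_list_of_multiset (image_mset ?g (mset_set E)) = map ?g es"
    by (metis sorted_list_of_multiset_mset sorted_sort_id)
  show ?thesis
  proof
    show "set (take ?m es) \<subseteq> E"
      using es set_take_subset by metis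
    show "card (set (take ?m es)) = ?m"
      using es(2) \<open>length es = card E\<close> by (simp add: distinct_card)
    show "tau E K x = sum ?g (set (take ?m es))"
      using es(2) assms(1)
      by (simp add: tau_eq_sum_list_take sorted_lengths take_map sum_list_distinct_conv_sum_set)
    fix a b
    assume "a \<in> set (take ?m es)" "b \<in> E - set (take ?m es)"
    moreover have "set es = set (take ?m es) \<union> set (drop ?m es)"
      by (metis append_take_drop_id set_append)
    ultimately have "b \<in> set (drop ?m es)"
      using es(1) by blast
    moreover have "sorted (map ?g (take ?m es) @ map ?g (drop ?m es))"
      using es(3) by (simp flip: map_append)
    ultimately show "?g a \<le> ?g b"
      using \<open>a \<in> set (take ?m es)\<close> by (auto simp: sorted_append)
  qed
qed

lemma tau_attained:
  assumes "K \<le> card E" "finite E"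
  obtains S where "S \<subseteq> E" "card S = card E - K" "tau E K x = sum (edge_length x) S"
  using tau_eq_sum_smallest[OF assms] by metis

lemma tau_le_sum:
  assumes "K \<le> card E" "finite E" "S \<subseteq> E" "card S = card E - K"
  shows "tau E K x \<le> sum (edge_length x) S"
proof -
  obtain T where T: "T \<subseteq> E" "card T = card E - K" "tau E K x = sum (edge_length x) T"
    "\<And>a b. a \<in> T \<Longrightarrow> b \<in> E - T \<Longrightarrow> edge_length x a \<le> edge_length x b"
    using tau_eq_sum_smallest[OF assms(1,2)] by metis
  with assms have "sum (edge_length x) T \<le> sum (edge_length x) S"
    by (intro sum_smallest_le) (auto intro: finite_subset)
  with T show ?thesis by simp
qed

section \<open>Contracting a set of edges\<close>

text \<open>
  The function \<open>r\<close> maps a vertex to the chosen vertex of its component. Simply bounding distances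
  inside components by the total length of \<open>S\<close> does not survive the insertion of an edge that
  joins two components, since the lengths of both would be counted twice. The induction therefore
  carries a budget \<open>w\<close> per component that bounds the diameter, with the budgets adding up to at most
  the total length; merging two components adds their budgets and the length of the joining edge.
\<close>

lemma contract_edges:
  fixes x :: "real ^ 'p ^ 'n::finite"
  assumes "finite S" "\<And>e. e \<in> S \<Longrightarrow> \<exists>i j. e = {i, j}"
  obtains r :: "'n \<Rightarrow> 'n" where "\<And>i j. {i, j} \<in> S \<Longrightarrow> r i = r j"
    "\<And>i. norm (x $ i - x $ r i) \<le> sum (edge_length x) S"
proof -
  have "\<exists>(r :: 'n \<Rightarrow> 'n) (w :: 'n \<Rightarrow> real).
      (\<forall>i j. {i, j} \<in> S \<longrightarrow> r i = r j) \<and> (\<forall>i. r (r i) = r i) \<and>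
      (\<forall>i j. r i = r j \<longrightarrow> norm (x $ i - x $ j) \<le> w (r i)) \<and>
      (\<forall>c. 0 \<le> w c) \<and> sum w UNIV \<le> sum (edge_length x) S"
    using assms
  proof (induction S rule: finite_induct)
    case empty
    show ?case
      by (rule exI[of _ id], rule exI[of _ "\<lambda>_. 0"]) auto
  next
    case (insert e S)
    then obtain r w where r: "\<And>i j. {i, j} \<in> S \<Longrightarrow> r i = r j" "\<And>i. r (r i) = r i"
      and diam: "\<And>i j. r i = r j \<Longrightarrow> norm (x $ i - x $ j) \<le> w (r i)"
      and w: "\<And>c. 0 \<le> w c" "sum w UNIV \<le> sum (edge_length x) S"
      by (metis insertI2)
    obtain a b where e: "e = {a, b}"
      using insert.prems by blast
    let ?l = "norm (x $ a - x $ b)"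
    have l: "sum (edge_length x) (insert e S) = ?l + sum (edge_length x) S"
      using insert.hyps by (simp add: e edge_length_pair)
    show ?case
    proof (cases "r a = r b")
      case True
      show ?thesis
      proof (intro exI conjI allI impI)
        show "r i = r j" if "{i, j} \<in> insert e S" for i j
          using that r(1) True by (auto simp: e doubleton_eq_iff)
        show "sum w UNIV \<le> sum (edge_length x) (insert e S)"
          using w(2) l norm_ge_zero[of "x $ a - x $ b"] by linarith
      qed (use r diam w in auto)
    next
      case False
      define r' where "r' i = (if r i = r b then r a else r i)" for i
      define w' where "w' = w(r a := w (r a) + w (r b) + ?l, r b := 0)"
      have across: "norm (x $ i - x $ j) \<le> w (r a) + w (r b) + ?l"
        if "r i = r a" "r j = r b" for i j
      proof -
        have "x $ i - x $ j = (x $ i - x $ a) + (x $ a - x $ b) + (x $ b - x $ j)"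
          by simp
        also have "norm \<dots> \<le> norm (x $ i - x $ a) + ?l + norm (x $ b - x $ j)"
          by (intro order.trans[OF norm_triangle_ineq] add_right_mono norm_triangle_ineq)
        also have "\<dots> \<le> w (r a) + w (r b) + ?l"
          using diam[of i a] diam[of b j] that by simp
        finally show ?thesis .
      qed
      have w_w': "sum w' UNIV = sum w UNIV + ?l"
      proof -
        have "sum w' UNIV = w' (r a) + w' (r b) + sum w' (UNIV - {r a} - {r b})"
          using False by (simp add: sum.remove[of UNIV "r a"] sum.remove[of "UNIV - {r a}" "r b"])
        also have "sum w' (UNIV - {r a} - {r b}) = sum w (UNIV - {r a} - {r b})"
          by (intro sum.cong) (auto simp: w'_def)
        also have "w' (r a) + w' (r b) = w (r a) + w (r b) + ?l"
          using False by (simp add: w'_def)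
        finally show ?thesis
          using False by (simp add: sum.remove[of UNIV "r a" w] sum.remove[of "UNIV - {r a}" "r b" w])
      qed
      show ?thesis
      proof (intro exI conjI allI impI)
        show "r' i = r' j" if "{i, j} \<in> insert e S" for i j
          using that r(1)[of i j] by (auto simp: e doubleton_eq_iff r'_def)
        show "r' (r' i) = r' i" for i
          using r(2) False by (auto simp: r'_def)
        show "norm (x $ i - x $ j) \<le> w' (r' i)" if "r' i = r' j" for i j
        proof (cases "r i = r j")
          case True
          have "w (r i) \<le> w' (r' i)"
            using w(1)[of "r a"] w(1)[of "r b"] False by (auto simp: r'_def w'_def)
          with True diam show ?thesis
            using order.trans by blast
        next
          case False
          with that have "r i = r a \<and> r j = r b \<or> r i = r b \<and> r j = r a"
            and "w' (r' i) = w (r a) + w (r b) + ?l"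
            using \<open>r a \<noteq> r b\<close> by (auto simp: r'_def w'_def split: if_splits)
          then show ?thesis
            using across[of i j] across[of j i] by (auto simp: norm_minus_commute)
        qed
        show "0 \<le> w' c" for c
          using w(1) by (simp add: w'_def)
        show "sum w' UNIV \<le> sum (edge_length x) (insert e S)"
          using w_w' w(2) l by linarith
      qed
    qed
  qed
  then obtain r :: "'n \<Rightarrow> 'n" and w :: "'n \<Rightarrow> real"
    where r: "\<And>i j. {i, j} \<in> S \<Longrightarrow> r i = r j" "\<And>i. r (r i) = r i"
      and diam: "\<And>i j. r i = r j \<Longrightarrow> norm (x $ i - x $ j) \<le> w (r i)"
      and w: "\<And>c. 0 \<le> w c" "sum w UNIV \<le> sum (edge_length x) S"
    by metis
  show ?thesis
  proof (rule that[of r])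
    fix i
    have "norm (x $ i - x $ r i) \<le> w (r i)"
      using diam r(2) by metis
    also have "\<dots> \<le> sum w UNIV"
      using w(1) by (intro member_le_sum) auto
    finally show "norm (x $ i - x $ r i) \<le> sum (edge_length x) S"
      using w(2) by linarith
  qed (rule r(1))
qed

section \<open>Smooth functions on balls\<close>

text \<open>The gradient is \<open>L\<close>-Lipschitz, so on the ball it stays within \<open>L * C\<close> of its value at \<open>0\<close>; a
  gradient bound on a convex set is a Lipschitz constant.\<close>

lemma L_smooth_lipschitz_on_cball:
  fixes f :: "'a::euclidean_space \<Rightarrow> real"
  assumes "L_smooth L f" "norm u \<le> C" "norm v \<le> C"
  shows "\<bar>f u - f v\<bar> \<le> (norm (grad f 0) + L * C) * norm (u - v)"
proof -
  have deriv: "(f has_derivative (\<lambda>h. h \<bullet> grad f z)) (at z within cball 0 C)" for z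
    using assms(1) gderiv_grad[of f z]
    by (auto simp: L_smooth_def gderiv_def intro: has_derivative_at_withinI)
  have "onorm (\<lambda>h. h \<bullet> grad f z) \<le> norm (grad f 0) + L * C" if "z \<in> cball 0 C" for z
  proof (rule onorm_le)
    fix h
    have "norm (grad f z - grad f 0) \<le> L * norm (z - 0)"
      using assms(1) unfolding L_smooth_def by blast
    also have "\<dots> \<le> L * C"
      using that assms(1) by (auto simp: L_smooth_def intro: mult_left_mono)
    finally have "norm (grad f z) \<le> norm (grad f 0) + L * C"
      using norm_triangle_sub[of "grad f z" "grad f 0"] by linarith
    then show "norm (h \<bullet> grad f z) \<le> (norm (grad f 0) + L * C) * norm h"
      using Cauchy_Schwarz_ineq2[of h "grad f z"] mult_left_mono[of "norm (grad f z)" _ "norm h"]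
      by (fastforce simp: mult.commute)
  qed
  with deriv have "norm (f u - f v) \<le> (norm (grad f 0) + L * C) * norm (u - v)"
    by (intro differentiable_bound[where S = "cball 0 C"]) (use assms in auto)
  then show ?thesis by simp
qed

section \<open>Exactness of the penalty\<close>

text \<open>
  The descent direction: \<open>y\<close> is \<open>x\<close> with the shortest edges contracted, and the penalized cost
  decreases along the whole segment from \<open>x\<close> to \<open>y\<close>, not only at \<open>y\<close>, which is what makes
  the argument work for local minimizers.
\<close>

lemma penalized_cost_descent:
  fixes x :: "real ^ 'p ^ 'n::finite"
  assumes E: "\<And>e. e \<in> E \<Longrightarrow> \<exists>i j. e = {i, j}" and K: "K \<le> card E"
    and smooth: "\<And>i. L_smooth (L i) (f i)"
    and C: "\<And>i. norm (x $ i) \<le> C"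
    and \<gamma>: "\<gamma> > (\<Sum>i\<in>UNIV. norm (grad (f i) 0) + L i * C)"
    and pos: "tau E K x > 0"
  obtains y where "\<And>t. 0 < t \<Longrightarrow> t \<le> 1 \<Longrightarrow>
    penalized_cost f E K \<gamma> (x + t *\<^sub>R (y - x)) < penalized_cost f E K \<gamma> x"
proof -
  obtain S where S: "S \<subseteq> E" "card S = card E - K" "tau E K x = sum (edge_length x) S"
    using tau_attained[OF K] by auto
  obtain r where r: "\<And>i j. {i, j} \<in> S \<Longrightarrow> r i = r j"
    "\<And>i. norm (x $ i - x $ r i) \<le> tau E K x"
    using contract_edges[of S x] S E by (metis finite subsetD)
  define y where "y = (\<chi> i. x $ r i)"
  define M where "M i = norm (grad (f i) 0) + L i * C" for i
  have "0 \<le> C"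
    using C norm_ge_zero order.trans by blast
  then have M_nonneg: "0 \<le> M i" for i
    using smooth[of i] by (simp add: M_def L_smooth_def)
  show ?thesis
  proof (rule that[of y])
    fix t :: real
    assume t: "0 < t" "t \<le> 1"
    define z where "z = x + t *\<^sub>R (y - x)"
    have z_nth: "z $ i = (1 - t) *\<^sub>R x $ i + t *\<^sub>R x $ r i" for i
      by (simp add: z_def y_def algebra_simps)
    have "edge_length z e = (1 - t) * edge_length x e" if "e \<in> S" for e
    proof -
      obtain i j where e: "e = {i, j}"
        using E S(1) \<open>e \<in> S\<close> by blast
      then have "r i = r j"
        using r(1) that by blast
      then have "z $ i - z $ j = (1 - t) *\<^sub>R (x $ i - x $ j)"
        by (simp add: z_nth scaleR_right_diff_distrib)
      then show ?thesis
        using t by (simp add: e edge_length_pair)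
    qed
    then have tau_z: "tau E K z \<le> (1 - t) * tau E K x"
      using tau_le_sum[OF K _ S(1,2), of z] S(3) by (simp add: sum_distrib_left)
    have cost: "f i (z $ i) - f i (x $ i) \<le> M i * (t * tau E K x)" for i
    proof -
      have "norm (z $ i) \<le> C"
      proof -
        have "(1 - t) *\<^sub>R x $ i + t *\<^sub>R x $ r i \<in> cball 0 C"
          by (rule convexD[OF convex_cball]) (use C t in auto)
        then show ?thesis by (simp add: z_nth)
      qed
      then have "\<bar>f i (z $ i) - f i (x $ i)\<bar> \<le> M i * norm (z $ i - x $ i)"
        unfolding M_def by (rule L_smooth_lipschitz_on_cball[OF smooth _ C])
      moreover have "norm (z $ i - x $ i) \<le> t * tau E K x"
      proof -
        have "z $ i - x $ i = t *\<^sub>R (x $ r i - x $ i)"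
          by (simp add: z_nth algebra_simps)
        then show ?thesis
          using r(2)[of i] t by (simp add: norm_minus_commute)
      qed
      ultimately show ?thesis
        using mult_left_mono[OF _ M_nonneg[of i]] by fastforce
    qed
    have "total_cost f z - total_cost f x = (\<Sum>i\<in>UNIV. f i (z $ i) - f i (x $ i))"
      by (simp add: total_cost_def sum_subtractf)
    also have "\<dots> \<le> (\<Sum>i\<in>UNIV. M i) * (t * tau E K x)"
      unfolding sum_distrib_right by (intro sum_mono cost)
    also have "\<dots> < \<gamma> * (t * tau E K x)"
      using \<gamma> t pos by (intro mult_strict_right_mono) (auto simp: M_def)
    finally have "total_cost f z < total_cost f x + \<gamma> * (t * tau E K x)"
      by simp
    moreover have "0 \<le> \<gamma>"
      using \<gamma> sum_nonneg[of UNIV M] M_nonneg by (simp add: M_def)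
    then have "\<gamma> * tau E K z \<le> \<gamma> * ((1 - t) * tau E K x)"
      using tau_z by (rule mult_left_mono[rotated])
    ultimately show "penalized_cost f E K \<gamma> (x + t *\<^sub>R (y - x)) < penalized_cost f E K \<gamma> x"
      unfolding z_def[symmetric] by (simp add: penalized_cost_def algebra_simps)
  qed
qed

lemma locally_optimal_imp_tau_zero:
  fixes x :: "real ^ 'p ^ 'n::finite"
  assumes E: "\<And>e. e \<in> E \<Longrightarrow> \<exists>i j. e = {i, j}" and K: "K \<le> card E"
    and smooth: "\<And>i. L_smooth (L i) (f i)"
    and C: "\<And>i. norm (x $ i) \<le> C"
    and \<gamma>: "\<gamma> > (\<Sum>i\<in>UNIV. norm (grad (f i) 0) + L i * C)"
    and opt: "locally_optimal (penalized_cost f E K \<gamma>) UNIV x"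
  shows "tau E K x = 0"
proof (rule ccontr)
  assume "tau E K x \<noteq> 0"
  moreover have "tau E K x \<ge> 0"
  proof -
    obtain S where S: "S \<subseteq> E" "tau E K x = sum (edge_length x) S"
      using tau_attained[OF K finite] by metis
    have "0 \<le> edge_length x e" if "e \<in> S" for e
    proof -
      obtain i j where "e = {i, j}" using E S(1) \<open>e \<in> S\<close> by blast
      then show ?thesis by (simp add: edge_length_pair)
    qed
    then show ?thesis using S(2) sum_nonneg by metis
  qed
  ultimately have "tau E K x > 0" by simp
  then obtain y where y: "\<And>t. 0 < t \<Longrightarrow> t \<le> 1 \<Longrightarrow>
      penalized_cost f E K \<gamma> (x + t *\<^sub>R (y - x)) < penalized_cost f E K \<gamma> x"
    using penalized_cost_descent[OF E K smooth C \<gamma>] by blast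
  obtain \<epsilon> where \<epsilon>: "\<epsilon> > 0" "optimal (penalized_cost f E K \<gamma>) (UNIV \<inter> ball x \<epsilon>) x"
    using opt unfolding locally_optimal_def by blast
  \<comment> \<open>This step size keeps the moved point inside the ball and does not exceed \<open>1\<close>.\<close>
  define t where "t = \<epsilon> / (\<epsilon> + norm (y - x))"
  have "\<epsilon> + norm (y - x) > 0"
    using \<epsilon>(1) by (simp add: add_pos_nonneg)
  then have t: "0 < t" "t \<le> 1" and "t * norm (y - x) < \<epsilon>"
    using \<epsilon>(1) by (auto simp: t_def field_simps)
  then have "x + t *\<^sub>R (y - x) \<in> ball x \<epsilon>"
    by (simp add: dist_norm)
  with \<epsilon>(2) y[OF t] show False
    by (auto simp: optimal_def is_arg_min_def)
qed

lemma optimal_penalized_imp_optimal_constrained: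
  assumes "optimal (penalized_cost f E K \<gamma>) U x" "tau E K x = 0"
  shows "optimal (total_cost f) ({x. tau E K x = 0} \<inter> U) x"
  using assms by (auto simp: optimal_def is_arg_min_def penalized_cost_def)

lemma optimal_imp_locally_optimal: "locally_optimal F S x" if "optimal F S x"
  using that unfolding locally_optimal_def optimal_def is_arg_min_def
  by (intro exI[of _ 1]) auto

theorem theorem2:
  fixes E :: "'n::finite set set" and K :: nat and f :: "'n \<Rightarrow> real ^ 'p \<Rightarrow> real"
  assumes "E \<subseteq> {{i, j} | i j. i \<noteq> j}"
    and "K \<le> card E"
  shows
    "(\<forall>(L :: 'n \<Rightarrow> real) (X :: real \<Rightarrow> real ^ 'p ^ 'n) (C :: real).
        (\<forall>i. L_smooth (L i) (f i)) \<and>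
        (\<forall>\<gamma>>0. optimal (penalized_cost f E K \<gamma>) UNIV (X \<gamma>)) \<and>
        C > 0 \<and> (\<forall>\<gamma>>0. \<forall>i. norm (X \<gamma> $ i) \<le> C) \<longrightarrow>
        (\<forall>\<gamma>>0. \<gamma> > (\<Sum>i\<in>UNIV. norm (grad (f i) 0) + 2 * L i * C) \<longrightarrow>
           optimal (total_cost f) {x. tau E K x = 0} (X \<gamma>)))
     \<and>
     (\<forall>(L :: 'n \<Rightarrow> real) (X :: real \<Rightarrow> real ^ 'p ^ 'n) (C :: real).
        (\<forall>i. L_smooth (L i) (f i) \<and> convex_on UNIV (f i)) \<and>
        (\<forall>\<gamma>>0. locally_optimal (penalized_cost f E K \<gamma>) UNIV (X \<gamma>)) \<and>
        C > 0 \<and> (\<forall>\<gamma>>0. \<forall>i. norm (X \<gamma> $ i) \<le> C) \<longrightarrow>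
        (\<forall>\<gamma>>0. \<gamma> > (\<Sum>i\<in>UNIV. norm (grad (f i) 0) + 2 * L i * C) \<longrightarrow>
           locally_optimal (total_cost f) {x. tau E K x = 0} (X \<gamma>)))"
proof -
  have edges: "\<exists>i j. e = {i, j}" if "e \<in> E" for e
    using that assms(1) by blast
  have tau_zero: "tau E K x = 0"
    if smooth: "\<forall>i. L_smooth (L i) (f i)" and "C > 0" and bound: "\<forall>i. norm (x $ i) \<le> C"
      and \<gamma>: "\<gamma> > (\<Sum>i\<in>UNIV. norm (grad (f i) 0) + 2 * L i * C)"
      and opt: "locally_optimal (penalized_cost f E K \<gamma>) UNIV x"
    for L C x \<gamma>
  proof (rule locally_optimal_imp_tau_zero[OF edges assms(2) _ _ _ opt])
    show "L_smooth (L i) (f i)" and "norm (x $ i) \<le> C" for i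
      using smooth bound by auto
    have "0 \<le> L i * C" for i
      using smooth \<open>C > 0\<close> by (simp add: L_smooth_def less_imp_le)
    then have "(\<Sum>i\<in>UNIV. norm (grad (f i) 0) + L i * C)
        \<le> (\<Sum>i\<in>UNIV. norm (grad (f i) 0) + 2 * L i * C)"
      by (intro sum_mono) (simp add: algebra_simps)
    with \<gamma> show "\<gamma> > (\<Sum>i\<in>UNIV. norm (grad (f i) 0) + L i * C)"
      by linarith
  qed
  show ?thesis
  proof (intro conjI allI impI; elim conjE)
    fix L :: "'n \<Rightarrow> real" and X :: "real \<Rightarrow> real ^ 'p ^ 'n" and C \<gamma> :: real
    assume "\<forall>i. L_smooth (L i) (f i)" "C > 0" "\<gamma> > 0"
      and "\<gamma> > (\<Sum>i\<in>UNIV. norm (grad (f i) 0) + 2 * L i * C)"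
      and "\<forall>\<gamma>>0. \<forall>i. norm (X \<gamma> $ i) \<le> C"
      and "\<forall>\<gamma>>0. optimal (penalized_cost f E K \<gamma>) UNIV (X \<gamma>)"
    then have "optimal (penalized_cost f E K \<gamma>) UNIV (X \<gamma>)" "tau E K (X \<gamma>) = 0"
      using tau_zero[of L C "X \<gamma>" \<gamma>] optimal_imp_locally_optimal by blast+
    then show "optimal (total_cost f) {x. tau E K x = 0} (X \<gamma>)"
      using optimal_penalized_imp_optimal_constrained by fastforce
  next
    fix L :: "'n \<Rightarrow> real" and X :: "real \<Rightarrow> real ^ 'p ^ 'n" and C \<gamma> :: real
    assume "\<forall>i. L_smooth (L i) (f i) \<and> convex_on UNIV (f i)" "C > 0" "\<gamma> > 0"
      and "\<gamma> > (\<Sum>i\<in>UNIV. norm (grad (f i) 0) + 2 * L i * C)"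
      and "\<forall>\<gamma>>0. \<forall>i. norm (X \<gamma> $ i) \<le> C"
      and "\<forall>\<gamma>>0. locally_optimal (penalized_cost f E K \<gamma>) UNIV (X \<gamma>)"
    then have "locally_optimal (penalized_cost f E K \<gamma>) UNIV (X \<gamma>)" "tau E K (X \<gamma>) = 0"
      using tau_zero[of L C "X \<gamma>" \<gamma>] by blast+
    then show "locally_optimal (total_cost f) {x. tau E K x = 0} (X \<gamma>)"
      using optimal_penalized_imp_optimal_constrained unfolding locally_optimal_def
      by fastforce
  qed
qed

end
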